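(* Let $n,p$ be positive integers and let $\mathcal{A},\mathcal{B}\in\mathbb{H}^{n\times n\times p}_{++}$ be T-positive definite tensors. Then: (i) (Identity property) $\mathcal{A}\#\mathcal{A}=\mathcal{A}$. (ii) (Inversion property) $(\mathcal{A}\#\mathcal{B})^{-1}=\mathcal{A}^{-1}\#\mathcal{B}^{-1}$. (iii) (Commutative property) $\mathcal{A}\#\mathcal{B}=\mathcal{B}\#\mathcal{A}$. (iv) (Transformation property) For every invertible $\mathcal{C}\in\mathbb{C}^{n\times n\times p}$, with $\Gamma_{\mathcal{C}}$ defined by $\Gamma_{\mathcal{C}}(\mathcal{A})=\mathcal{C}^H*\mathcal{A}*\mathcal{C}$, one has $\Gamma_{\mathcal{C}}(\mathcal{A})\#\Gamma_{\mathcal{C}}(\mathcal{B})=\Gamma_{\mathcal{C}}(\mathcal{A}\#\mathcal{B})$.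
   Context: A tensor $\mathcal{A}\in\mathbb{C}^{m\times n\times p}$ has frontal slices $A^{(1)},\dots,A^{(p)}\in\mathbb{C}^{m\times n}$. $\operatorname{bcirc}(\mathcal{A})\in\mathbb{C}^{mp\times np}$ is the block circulant matrix whose $(j,l)$ block is $A^{(((j-l)\bmod p)+1)}$ (first block column $A^{(1)},\dots,A^{(p)}$); $\operatorname{unfold}(\mathcal{A})$ is the block column $A^{(1)},\dots,A^{(p)}$, and $\operatorname{fold}$ is its inverse. The T-product of $\mathcal{A}\in\mathbb{C}^{m\times n\times p}$ and $\mathcal{B}\in\mathbb{C}^{n\times s\times p}$ is $\mathcal{A}*\mathcal{B}=\operatorname{fold}(\operatorname{bcirc}(\mathcal{A})\cdot\operatorname{unfold}(\mathcal{B}))\in\mathbb{C}^{m\times s\times p}$. The identity tensor $\mathcal{I}_{n,p}$ has first frontal slice $I_n$ and all others zero; $\mathcal{A}\in\mathbb{C}^{n\times n\times p}$ is invertible if there is $\mathcal{A}^{-1}$ with $\mathcal{A}*\mathcal{A}^{-1}=\mathcal{A}^{-1}*\mathcal{A}=\mathcal{I}_{n,p}$. The T-conjugate transpose $\mathcal{A}^H$ has frontal slices $(A^{(1)})^H,(A^{(p)})^H,\dots,(A^{(2)})^H$, in this order. $\mathcal{A}\in\mathbb{C}^{n\times n\times p}$ is T-Hermitian if $\mathcal{A}^H=\mathcal{A}$; $\mathbb{H}^{n\times n\times p}$ is the set of these. The Frobenius inner product is $\langle\mathcal{A},\mathcal{B}\rangle=\sum_{i,j,k}\overline{a_{ijk}}b_{ijk}$.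 A tensor $\mathcal{A}\in\mathbb{H}^{n\times n\times p}$ is T-positive definite if $\langle\mathcal{X},\mathcal{A}*\mathcal{X}\rangle>0$ for all nonzero $\mathcal{X}\in\mathbb{C}^{n\times1\times p}$ (equivalently, $\operatorname{bcirc}(\mathcal{A})$ is Hermitian positive definite); $\mathbb{H}^{n\times n\times p}_{++}$ is the set of these. Each $\mathcal{A}\in\mathbb{H}^{n\times n\times p}_{++}$ is invertible with $\mathcal{A}^{-1}\in\mathbb{H}^{n\times n\times p}_{++}$, and has a unique T-positive definite square root $\mathcal{A}^{1/2}$; $\mathcal{A}^{-1/2}=(\mathcal{A}^{1/2})^{-1}$. For $\mathcal{A},\mathcal{B}\in\mathbb{H}^{n\times n\times p}_{++}$ the geometric mean is $\mathcal{A}\#\mathcal{B}=\mathcal{A}^{1/2}*(\mathcal{A}^{-1/2}*\mathcal{B}*\mathcal{A}^{-1/2})^{1/2}*\mathcal{A}^{1/2}\in\mathbb{H}^{n\times n\times p}_{++}$. *)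

theory Defs
  imports "Jordan_Normal_Form.Matrix" "Jordan_Normal_Form.Schur_Decomposition"
begin

text \<open>
  A third-order tensor is the list of its frontal slices. All indices are 0-based:
  the slice written \<open>A\<^sup>(\<^sup>k\<^sup>+\<^sup>1\<^sup>)\<close> on paper is \<open>A ! k\<close>, and its
  \<open>(i, j)\<close> entry is \<open>A ! k $$ (i, j)\<close>.
\<close>

type_synonym tensor = "complex mat list"

definition tensors :: "nat \<Rightarrow> nat \<Rightarrow> nat \<Rightarrow> tensor set" where
  "tensors m n p = {A. length A = p \<and> (\<forall>k<p. A ! k \<in> carrier_mat m n)}"

text \<open>The dimensions of the slices are read off the first slice, so they are only
  meaningful for tensors with at least one slice.\<close>

definition trows :: "tensor \<Rightarrow> nat" where
  "trows A = dim_row (A ! 0)"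

definition tcols :: "tensor \<Rightarrow> nat" where
  "tcols A = dim_col (A ! 0)"

text \<open>Row \<open>r\<close> and column \<open>c\<close> of the block circulant matrix lie in block
  \<open>(r div m, c div n)\<close>; since \<open>c div n < p\<close>, adding \<open>p\<close> first makes the
  subtraction modulo \<open>p\<close> correct on natural numbers.\<close>

definition bcirc :: "tensor \<Rightarrow> complex mat" where
  "bcirc A = (let m = trows A; n = tcols A; p = length A in
     mat (m * p) (n * p)
       (\<lambda>(r, c). A ! ((p + r div m - c div n) mod p) $$ (r mod m, c mod n)))"

definition tunfold :: "tensor \<Rightarrow> complex mat" where
  "tunfold A = (let m = trows A in
     mat (m * length A) (tcols A) (\<lambda>(r, c). A ! (r div m) $$ (r mod m, c)))"

definition tfold :: "nat \<Rightarrow> nat \<Rightarrow> complex mat \<Rightarrow> tensor" where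
  "tfold m p M =
     map (\<lambda>k. mat m (dim_col M) (\<lambda>(i, j). M $$ (k * m + i, j))) [0..<p]"

definition tprod :: "tensor \<Rightarrow> tensor \<Rightarrow> tensor"  (infixl \<open>*\<^sub>T\<close> 70) where
  "A *\<^sub>T B = tfold (trows A) (length A) (bcirc A * tunfold B)"

definition tid :: "nat \<Rightarrow> nat \<Rightarrow> tensor" where
  "tid n p = map (\<lambda>k. if k = 0 then 1\<^sub>m n else 0\<^sub>m n n) [0..<p]"

definition tzero :: "nat \<Rightarrow> nat \<Rightarrow> nat \<Rightarrow> tensor" where
  "tzero m n p = replicate p (0\<^sub>m m n)"

definition is_tinverse :: "tensor \<Rightarrow> tensor \<Rightarrow> bool" where
  "is_tinverse A X \<longleftrightarrow> (let n = trows A; p = length A in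
     X \<in> tensors n n p \<and> A *\<^sub>T X = tid n p \<and> X *\<^sub>T A = tid n p)"

definition tinvertible :: "nat \<Rightarrow> nat \<Rightarrow> tensor \<Rightarrow> bool" where
  "tinvertible n p A \<longleftrightarrow> A \<in> tensors n n p \<and> (\<exists>X. is_tinverse A X)"

definition tinv :: "tensor \<Rightarrow> tensor" where
  "tinv A = (THE X. is_tinverse A X)"

text \<open>The index \<open>(p - k) mod p\<close> fixes slice \<open>0\<close> and reverses the others.\<close>

definition tconj_transpose :: "tensor \<Rightarrow> tensor"  (\<open>_\<^sup>H\<close> [1000] 999) where
  "A\<^sup>H = map (\<lambda>k. mat_adjoint (A ! ((length A - k) mod length A))) [0..<length A]"

definition THermitian :: "nat \<Rightarrow> nat \<Rightarrow> tensor set" where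
  "THermitian n p = {A \<in> tensors n n p. A\<^sup>H = A}"

definition tinner :: "tensor \<Rightarrow> tensor \<Rightarrow> complex" where
  "tinner A B =
     (\<Sum>i<trows A. \<Sum>j<tcols A. \<Sum>k<length A. cnj (A ! k $$ (i, j)) * B ! k $$ (i, j))"

text \<open>The order on \<^typ>\<open>complex\<close> makes \<open>0 < z\<close> mean that \<open>z\<close> is real and positive.\<close>

definition Tposdef :: "nat \<Rightarrow> nat \<Rightarrow> tensor set" where
  "Tposdef n p = {A \<in> THermitian n p.
     \<forall>X \<in> tensors n 1 p. X \<noteq> tzero n 1 p \<longrightarrow> 0 < tinner X (A *\<^sub>T X)}"

text \<open>Every T-positive definite tensor has exactly one T-positive definite square root;
  outside that domain \<open>tsqrt\<close> is unspecified, and likewise \<open>tinv\<close> on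
  tensors that are not invertible.\<close>

definition tsqrt :: "tensor \<Rightarrow> tensor" where
  "tsqrt A = (THE X. X \<in> Tposdef (trows A) (length A) \<and> X *\<^sub>T X = A)"

definition tgeomean :: "tensor \<Rightarrow> tensor \<Rightarrow> tensor"  (infixl \<open>\<sharp>\<close> 65) where
  "A \<sharp> B =
     tsqrt A *\<^sub>T tsqrt (tinv (tsqrt A) *\<^sub>T B *\<^sub>T tinv (tsqrt A)) *\<^sub>T tsqrt A"

definition Gamma_cong :: "tensor \<Rightarrow> tensor \<Rightarrow> tensor"  (\<open>\<Gamma>\<close>) where
  "\<Gamma> C A = C\<^sup>H *\<^sub>T A *\<^sub>T C"

end

theory Submission
  imports Defs "Jordan_Normal_Form.Spectral_Radius"
begin

text \<open>The geometric mean is characterised by an equation from which all four properties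
  can be read off: \<open>A \<sharp> B\<close> is the only positive definite solution \<open>G\<close> of
  the Riccati equation \<open>G A\<^sup>-\<^sup>1 G = B\<close>. Indeed, for \<open>R = A\<^sup>1\<^sup>/\<^sup>2\<close> the
  equation says that \<open>R\<^sup>-\<^sup>1 G R\<^sup>-\<^sup>1\<close> squares to \<open>R\<^sup>-\<^sup>1 B R\<^sup>-\<^sup>1\<close>, and positive
  square roots are unique. Now \<open>A A\<^sup>-\<^sup>1 A = A\<close> is the identity property; inverting
  both sides of the equation for \<open>G\<close> gives the equation for the inverse mean; solving it
  for \<open>A\<close> gives \<open>G B\<^sup>-\<^sup>1 G = A\<close>, that is, commutativity; and multiplying it by
  \<open>C\<^sup>H\<close> and \<open>C\<close> from the two sides gives the transformation property. The argument
  uses only a monoid with an involution and a set of positive elements that are invertible,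
  selfadjoint, stable under congruence by units and have unique positive square roots. It is
  carried out at that level of generality in the locale \<open>involutive_cone\<close>.

  Tensors form such a structure because \<open>bcirc\<close> is an injective homomorphism of
  involutive monoids onto the block circulant matrices, under which T-positive definite tensors
  correspond to positive definite matrices. Positive definite matrices are invertible and have
  unique positive square roots by the spectral theorem; what remains is that
  the inverse and the square root of a block circulant matrix are again block circulant. A
  matrix is block circulant if and only if it is fixed by conjugation with the unitary
  permutation matrix that shifts the blocks cyclically. Conjugation maps the inverse (or the
  positive square root) of a fixed matrix to another inverse (or positive square root) of the
  same matrix, so uniqueness makes it fixed too.
\<close>

section \<open>The adjoint of a complex matrix\<close>

lemma dim_mat_adjoint [simp]:
  "dim_row (mat_adjoint A) = dim_col A" "dim_col (mat_adjoint A) = dim_row A"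
  by (simp_all add: mat_adjoint_def)

lemma mat_adjoint_carrier [simp]: "A \<in> carrier_mat m n \<Longrightarrow> mat_adjoint A \<in> carrier_mat n m"
  by (metis carrier_matD carrier_matI dim_mat_adjoint)

lemma index_mat_adjoint [simp]:
  "i < dim_col A \<Longrightarrow> j < dim_row A \<Longrightarrow> mat_adjoint A $$ (i, j) = conjugate (A $$ (j, i))"
  by (simp add: mat_adjoint_def mat_of_rows_def)

lemma square_mult_carrier [simp]:
  "A \<in> carrier_mat n n \<Longrightarrow> B \<in> carrier_mat n n \<Longrightarrow> A * B \<in> carrier_mat n n"
  by (rule mult_carrier_mat)

lemma mult_mat_vec_zero [simp]:
  fixes A :: "'a :: semiring_0 mat"
  shows "A \<in> carrier_mat m n \<Longrightarrow> A *\<^sub>v 0\<^sub>v n = 0\<^sub>v m"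
  by (intro eq_vecI) auto

lemma mult_unit_vec_col:
  fixes A :: "'a :: semiring_1 mat"
  assumes "A \<in> carrier_mat m n" "i < n"
  shows "A *\<^sub>v unit_vec n i = col A i"
  using assms by (intro eq_vecI) auto

lemma mat_adjoint_adjoint [simp]: "mat_adjoint (mat_adjoint A) = A"
  by (rule eq_matI) auto

lemma mat_adjoint_one [simp]: "mat_adjoint (1\<^sub>m n :: complex mat) = 1\<^sub>m n"
  by (rule eq_matI) auto

lemma mat_adjoint_mult:
  fixes A B :: "complex mat"
  assumes "A \<in> carrier_mat m n" "B \<in> carrier_mat n k"
  shows "mat_adjoint (A * B) = mat_adjoint B * mat_adjoint A"
  using assms by (intro eq_matI) (auto simp: scalar_prod_def mult.commute intro!: sum.cong)

lemma cscalar_prod_mat_adjoint: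
  fixes A :: "complex mat"
  assumes "A \<in> carrier_mat m n" "v \<in> carrier_vec n" "w \<in> carrier_vec m"
  shows "(A *\<^sub>v v) \<bullet>c w = v \<bullet>c (mat_adjoint A *\<^sub>v w)"
proof -
  have "(A *\<^sub>v v) \<bullet>c w = (\<Sum>i<m. \<Sum>j<n. A $$ (i, j) * v $ j * cnj (w $ i))"
    using assms by (auto simp: scalar_prod_def sum_distrib_right atLeast0LessThan intro!: sum.cong)
  also have "\<dots> = (\<Sum>j<n. \<Sum>i<m. A $$ (i, j) * v $ j * cnj (w $ i))"
    by (rule sum.swap)
  also have "\<dots> = v \<bullet>c (mat_adjoint A *\<^sub>v w)"
    using assms
    by (auto simp: scalar_prod_def sum_distrib_left atLeast0LessThan mult_ac intro!: sum.cong)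
  finally show ?thesis .
qed

section \<open>The spectral theorem for Hermitian matrices\<close>

text \<open>Gram-Schmidt, applied to a basis that starts with \<open>v\<close>, keeps \<open>v\<close> as
  its first vector and yields pairwise orthogonal vectors; scaling them to length one gives
  the columns of \<open>U\<close>.\<close>

lemma unitary_completion:
  fixes v :: "complex vec"
  assumes v: "v \<in> carrier_vec n" "v \<noteq> 0\<^sub>v n"
  obtains U c where "U \<in> carrier_mat n n" "mat_adjoint U * U = 1\<^sub>m n" "col U 0 = c \<cdot>\<^sub>v v"
proof -
  have n: "0 < n"
    using v by (cases n) auto
  interpret cof_vec_space n "TYPE(complex)" .
  define b where "b = basis_completion v"
  define ws where "ws = gram_schmidt n b"
  note bc = basis_completion[OF v, folded b_def]
  obtain vs where bv: "b = v # vs"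
    using bc(6,7) n by (cases b) auto
  note gs = gram_schmidt_result[OF bc(2,4,5) refl, folded ws_def]
  have hd: "ws ! 0 = v" and len: "length ws = n"
    using gram_schmidt_hd[OF v(1), of vs, folded bv] gs(4) bc(6) n hd_conv_nth[of ws]
    by (auto simp: ws_def[symmetric])
  have wc: "ws ! i \<in> carrier_vec n" if "i < n" for i
    using gs(3) len that by (meson nth_mem subsetD)
  define s where "s i = complex_of_real (1 / sqrt (Re (ws ! i \<bullet>c ws ! i)))" for i
  define U where "U = mat n n (\<lambda>(r, i). s i * ws ! i $ r)"
  have U: "U \<in> carrier_mat n n"
    by (simp add: U_def)
  have ent: "(mat_adjoint U * U) $$ (i, j) = cnj (s i) * s j * (ws ! j \<bullet>c ws ! i)"
    if "i < n" "j < n" for i j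
    using that wc[OF that(1)] wc[OF that(2)]
    by (auto simp: U_def scalar_prod_def sum_distrib_left mult_ac intro!: sum.cong)
  have "mat_adjoint U * U = 1\<^sub>m n"
  proof (rule eq_matI)
    fix i j assume ij: "i < dim_row (1\<^sub>m n :: complex mat)" "j < dim_col (1\<^sub>m n :: complex mat)"
    then have i: "i < n" and j: "j < n"
      by auto
    show "(mat_adjoint U * U) $$ (i, j) = 1\<^sub>m n $$ (i, j)"
    proof (cases "i = j")
      case False
      then have "ws ! j \<bullet>c ws ! i = 0"
        using corthogonalD[OF gs(2), of j i] i j len by auto
      then show ?thesis
        using ent[OF i j] i j False by simp
    next
      case True
      have "ws ! i \<bullet>c ws ! i \<noteq> 0"
        using corthogonalD[OF gs(2), of i i] i len by auto
      then have "0 < ws ! i \<bullet>c ws ! i"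
        using conjugate_square_ge_0_vec[of "ws ! i"] by (simp add: order_less_le)
      then obtain x where x: "0 < x" "ws ! i \<bullet>c ws ! i = complex_of_real x"
        by (metis complex_is_Real_iff less_complex_def of_real_Re zero_complex.sel)
      then have "cnj (s i) * s i * (ws ! i \<bullet>c ws ! i) = 1"
        by (simp add: s_def real_sqrt_divide field_simps flip: of_real_mult)
      then show ?thesis
        using ent[OF i j] i True by simp
    qed
  qed (use U in auto)
  moreover have "col U 0 = s 0 \<cdot>\<^sub>v v"
    using n v hd by (intro eq_vecI) (auto simp: U_def)
  ultimately show thesis
    using that U by blast
qed

text \<open>The block diagonal matrix \<open>diag(e, M)\<close>, with \<open>e\<close> a one by one
  block.\<close>

definition bordered :: "complex \<Rightarrow> complex mat \<Rightarrow> complex mat" where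
  "bordered e M = four_block_mat (mat 1 1 (\<lambda>_. e)) (0\<^sub>m 1 (dim_col M)) (0\<^sub>m (dim_row M) 1) M"

lemma bordered_carrier: "M \<in> carrier_mat n n \<Longrightarrow> bordered e M \<in> carrier_mat (Suc n) (Suc n)"
  by (intro carrier_matI) (auto simp: bordered_def)

lemma mat_adjoint_bordered: "mat_adjoint (bordered e M) = bordered (cnj e) (mat_adjoint M)"
  by (intro eq_matI) (auto simp: bordered_def)

lemma bordered_one: "bordered 1 (1\<^sub>m n) = 1\<^sub>m (Suc n)"
  by (intro eq_matI) (auto simp: bordered_def)

lemma bordered_mult:
  assumes "M \<in> carrier_mat n n" "N \<in> carrier_mat n n"
  shows "bordered e M * bordered f N = bordered (e * f) (M * N)"
proof -
  have zero: "(0\<^sub>m 1 n :: complex mat) \<in> carrier_mat 1 n" "(0\<^sub>m n 1 :: complex mat) \<in> carrier_mat n 1"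
    by simp_all
  have one: "mat 1 1 (\<lambda>_. x) \<in> carrier_mat 1 1" for x :: complex
    by simp
  have "mat 1 1 (\<lambda>_. e) * mat 1 1 (\<lambda>_. f) = mat 1 1 (\<lambda>_. e * f)"
    by (intro eq_matI) (auto simp: scalar_prod_def)
  then show ?thesis
    using mult_four_block_mat[OF one zero assms(1) one zero assms(2), of e f] assms
      one[of e] one[of f] one[of "e * f"] 
    by (simp add: bordered_def)
qed

lemma diagonal_mat_bordered:
  assumes "M \<in> carrier_mat n n" "diagonal_mat M"
  shows "diagonal_mat (bordered e M)"
  using assms by (auto simp: diagonal_mat_def bordered_def)

text \<open>Induction on the dimension: in an orthonormal basis whose first vector is an eigenvector,
  the first column of the matrix is zero below the diagonal. Being Hermitian, the matrix is then
  block diagonal, and the remaining Hermitian block is one dimension smaller.\<close>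

lemma hermitian_diagonalization:
  fixes A :: "complex mat"
  assumes "A \<in> carrier_mat n n" "mat_adjoint A = A"
  obtains U D where "U \<in> carrier_mat n n" "mat_adjoint U * U = 1\<^sub>m n" "U * mat_adjoint U = 1\<^sub>m n"
    "D \<in> carrier_mat n n" "diagonal_mat D" "mat_adjoint U * A * U = D"
proof -
  have "\<exists>U. U \<in> carrier_mat n n \<and> mat_adjoint U * U = 1\<^sub>m n \<and> diagonal_mat (mat_adjoint U * A * U)"
    using assms
  proof (induction n arbitrary: A)
    case 0
    then show ?case
      by (intro exI[of _ "1\<^sub>m 0"]) (auto simp: diagonal_mat_def)
  next
    case (Suc n A)
    note A = Suc.prems(1)
    let ?N = "Suc n"
    note [simp] = assoc_mult_mat[of _ ?N ?N _ ?N _ ?N]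
    obtain e where "eigenvalue A e"
      using spectrum_non_empty[OF A] by (auto simp: spectrum_def)
    then obtain v where v: "v \<in> carrier_vec ?N" "v \<noteq> 0\<^sub>v ?N" and Av: "A *\<^sub>v v = e \<cdot>\<^sub>v v"
      using A by (auto simp: eigenvalue_def eigenvector_def)
    obtain U c where U: "U \<in> carrier_mat ?N ?N" and UU: "mat_adjoint U * U = 1\<^sub>m ?N"
      and U0: "col U 0 = c \<cdot>\<^sub>v v"
      using unitary_completion[OF v] by blast
    let ?U' = "mat_adjoint U"
    have U': "?U' \<in> carrier_mat ?N ?N"
      using U by simp
    define B where "B = ?U' * A * U"
    have B: "B \<in> carrier_mat ?N ?N"
      using U A by (simp add: B_def)
    have Bh: "mat_adjoint B = B"
      using U U' A Suc.prems(2)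
      by (simp add: B_def mat_adjoint_mult[of _ ?N ?N _ ?N])
    have "A *\<^sub>v col U 0 = e \<cdot>\<^sub>v col U 0"
      using A v by (simp add: U0 Av mult_mat_vec smult_smult_assoc mult.commute)
    then have "col (A * U) 0 = e \<cdot>\<^sub>v col U 0"
      using col_mult2[OF A U, of 0] by simp
    then have "col B 0 = e \<cdot>\<^sub>v col (?U' * U) 0"
      using A U U' mult_mat_vec[OF U', of "col U 0" e] col_dim[of U 0]
        col_mult2[OF U' square_mult_carrier[OF A U], of 0] col_mult2[OF U' U, of 0]
      by (simp add: B_def)
    then have B0: "B $$ (i, 0) = (if i = 0 then e else 0)" if "i < ?N" for i
      using that B by (auto simp: UU dest: arg_cong[of _ _ "\<lambda>w. w $ i"])
    \<comment> \<open>The first row is the conjugate of the first column.\<close>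
    have B0': "B $$ (0, i) = 0" if "i < ?N" "i \<noteq> 0" for i
      using arg_cong[OF Bh, of "\<lambda>M. M $$ (0, i)"] B0[of i] that B by simp
    define C where "C = mat n n (\<lambda>(i, j). B $$ (Suc i, Suc j))"
    have C: "C \<in> carrier_mat n n"
      by (simp add: C_def)
    have Ch: "mat_adjoint C = C"
    proof (rule eq_matI)
      fix i j assume "i < dim_row C" "j < dim_col C"
      then show "mat_adjoint C $$ (i, j) = C $$ (i, j)"
        using arg_cong[OF Bh, of "\<lambda>M. M $$ (Suc i, Suc j)"] B by (simp add: C_def)
    qed (simp_all add: C_def)
    have Bblock: "B = bordered e C"
      by (rule eq_matI) (use B in \<open>auto simp: C_def bordered_def B0 B0'\<close>)
    obtain V where V: "V \<in> carrier_mat n n" and VV: "mat_adjoint V * V = 1\<^sub>m n"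
      and Vd: "diagonal_mat (mat_adjoint V * C * V)"
      using Suc.IH[OF C Ch] by blast
    let ?V' = "mat_adjoint V"
    have V': "?V' \<in> carrier_mat n n"
      using V by simp
    define F where "F = bordered 1 V"
    have F: "F \<in> carrier_mat ?N ?N"
      using V by (simp add: F_def bordered_carrier)
    have F': "mat_adjoint F = bordered 1 ?V'"
      by (simp add: F_def mat_adjoint_bordered)
    have FF: "mat_adjoint F * F = 1\<^sub>m ?N"
      unfolding F' unfolding F_def using V V' by (simp add: bordered_mult[of _ n] VV bordered_one)
    have "mat_adjoint F * B * F = bordered e (?V' * C * V)"
      unfolding F' Bblock unfolding F_def using V V' C by (simp add: bordered_mult[of _ n] )
    then have diag: "diagonal_mat (mat_adjoint F * B * F)"
      using diagonal_mat_bordered[of "?V' * C * V" n e] Vd V V' C by simp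
    let ?W = "U * F"
    have "mat_adjoint ?W * ?W = mat_adjoint F * ((?U' * U) * F)"
      using U U' F by (simp add: mat_adjoint_mult[of _ ?N ?N _ ?N])
    also have "\<dots> = 1\<^sub>m ?N"
      using F FF by (simp add: UU)
    finally have "mat_adjoint ?W * ?W = 1\<^sub>m ?N" .
    moreover have "mat_adjoint ?W * A * ?W = mat_adjoint F * B * F"
      using U U' F A by (simp add: B_def mat_adjoint_mult[of _ ?N ?N _ ?N])
    ultimately show ?case
      using diag U F by (intro exI[of _ ?W]) simp
  qed
  then obtain U where U: "U \<in> carrier_mat n n" "mat_adjoint U * U = 1\<^sub>m n"
    "diagonal_mat (mat_adjoint U * A * U)"
    by blast
  moreover have "U * mat_adjoint U = 1\<^sub>m n"
    using mat_mult_left_right_inverse[OF mat_adjoint_carrier[OF U(1)] U(1,2)] .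
  moreover have "mat_adjoint U * A * U \<in> carrier_mat n n"
    using U(1) assms by (metis mat_adjoint_carrier mult_carrier_mat)
  ultimately show thesis
    using that by blast
qed

section \<open>Positive definite matrices and their square roots\<close>

definition posdef_mat :: "nat \<Rightarrow> complex mat \<Rightarrow> bool" where
  "posdef_mat n M \<longleftrightarrow> M \<in> carrier_mat n n \<and> mat_adjoint M = M
     \<and> (\<forall>v \<in> carrier_vec n. v \<noteq> 0\<^sub>v n \<longrightarrow> 0 < (M *\<^sub>v v) \<bullet>c v)"

lemma posdef_matD:
  assumes "posdef_mat n M"
  shows "M \<in> carrier_mat n n" "mat_adjoint M = M"
    "v \<in> carrier_vec n \<Longrightarrow> v \<noteq> 0\<^sub>v n \<Longrightarrow> 0 < (M *\<^sub>v v) \<bullet>c v"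
  using assms by (auto simp: posdef_mat_def)

lemma posdef_mat_one: "posdef_mat n (1\<^sub>m n)"
  by (simp add: posdef_mat_def)

text \<open>The quadratic form of \<open>C\<^sup>H M C\<close> at \<open>v\<close> is that of \<open>M\<close> at
  \<open>C v\<close>, and a left inverse of \<open>C\<close> prevents \<open>C v\<close> from vanishing.\<close>

lemma posdef_mat_congruence:
  assumes M: "posdef_mat n M" and C: "C \<in> carrier_mat n n" and D: "D \<in> carrier_mat n n"
    and DC: "D * C = 1\<^sub>m n"
  shows "posdef_mat n (mat_adjoint C * M * C)"
proof -
  note [simp] = assoc_mult_mat[of _ n n _ n _ n] assoc_mult_mat_vec[of _ n n _ n]
  note m = posdef_matD[OF M]
  have C': "mat_adjoint C \<in> carrier_mat n n"
    using C by simp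
  have "0 < ((mat_adjoint C * M * C) *\<^sub>v v) \<bullet>c v" if v: "v \<in> carrier_vec n" "v \<noteq> 0\<^sub>v n" for v
  proof -
    have "D *\<^sub>v (C *\<^sub>v v) = v"
      using DC C D v by (metis assoc_mult_mat_vec one_mult_mat_vec)
    then have "C *\<^sub>v v \<noteq> 0\<^sub>v n"
      using D v by auto
    then have "0 < (M *\<^sub>v (C *\<^sub>v v)) \<bullet>c (C *\<^sub>v v)"
      using m(3) C v by simp
    also have "\<dots> = ((mat_adjoint C * M * C) *\<^sub>v v) \<bullet>c v"
      using C C' m(1) v by (simp add: cscalar_prod_mat_adjoint[of "mat_adjoint C" n n])
    finally show ?thesis .
  qed
  moreover have "mat_adjoint (mat_adjoint C * M * C) = mat_adjoint C * M * C"
    using C C' m by (simp add: mat_adjoint_mult[of _ n n _ n])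
  ultimately show ?thesis
    using C C' m(1) by (simp add: posdef_mat_def)
qed

lemma posdef_mat_inverse_ex:
  assumes "posdef_mat n M"
  obtains X where "X \<in> carrier_mat n n" "M * X = 1\<^sub>m n" "X * M = 1\<^sub>m n"
proof -
  note m = posdef_matD[OF assms]
  have "det M \<noteq> 0"
    using m(3) det_0_iff_vec_prod_zero[OF m(1)] by fastforce
  then obtain X where X: "X \<in> carrier_mat n n" "X * M = 1\<^sub>m n" 
    using det_non_zero_imp_unit[OF m(1), of n] by (auto simp: Units_def ring_mat_def)
  then show thesis
    using that mat_mult_left_right_inverse[OF X(1) m(1) X(2)] by blast
qed

text \<open>Diagonalise \<open>M = U D U\<^sup>H\<close> and put \<open>C = D\<^sup>1\<^sup>/\<^sup>4 U\<^sup>H\<close>. The square root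
  \<open>U D\<^sup>1\<^sup>/\<^sup>2 U\<^sup>H\<close> is \<open>C\<^sup>H C\<close>; fourth roots are taken so that its positivity is an
  instance of congruence invariance.\<close>

lemma posdef_mat_sqrt_ex:
  assumes "posdef_mat n M"
  obtains S where "posdef_mat n S" "S * S = M"
proof -
  note m = posdef_matD[OF assms]
  note [simp] = assoc_mult_mat[of _ n n _ n _ n]
  obtain U D where U: "U \<in> carrier_mat n n" "mat_adjoint U * U = 1\<^sub>m n" "U * mat_adjoint U = 1\<^sub>m n"
    and D: "D \<in> carrier_mat n n" "diagonal_mat D" "mat_adjoint U * M * U = D"
    using hermitian_diagonalization[OF m(1,2)] by metis
  let ?U' = "mat_adjoint U"
  have U': "?U' \<in> carrier_mat n n"
    using U by simp
  have "posdef_mat n D"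
    using posdef_mat_congruence[OF assms U(1) U' U(2)] D(3) by simp
  have pos: "0 < D $$ (i, i)" if "i < n" for i
  proof -
    have "0 < (D *\<^sub>v unit_vec n i) \<bullet>c unit_vec n i"
      using posdef_matD(3)[OF \<open>posdef_mat n D\<close>, of "unit_vec n i"] that by simp
    also have "\<dots> = D $$ (i, i)"
    proof -
      have "conjugate (unit_vec n i :: complex vec) = unit_vec n i"
        by (rule eq_vecI) (auto simp: unit_vec_def)
      then show ?thesis
        using D(1) that by (simp)
    qed
    finally show ?thesis .
  qed
  define r where "r i = sqrt (sqrt (Re (D $$ (i, i))))" for i
  have r: "0 < r i" "complex_of_real (r i) * r i * (r i * r i) = D $$ (i, i)" if "i < n" for i
  proof -
    obtain x where x: "0 < x" "D $$ (i, i) = complex_of_real x"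
      using pos[OF \<open>i < n\<close>]
      by (metis complex_is_Real_iff less_complex_def of_real_Re zero_complex.sel)
    then show "0 < r i" "complex_of_real (r i) * r i * (r i * r i) = D $$ (i, i)"
      by (simp_all add: r_def flip: of_real_mult)
  qed
  define E where "E f = mat n n (\<lambda>(i, j). if i = j then complex_of_real (f i) else 0)" for f
  have E: "E f \<in> carrier_mat n n" for f
    by (simp add: E_def)
  have EE: "E f * E g = E (\<lambda>i. f i * g i)" for f g
  proof (rule eq_matI)
    fix i j assume "i < dim_row (E (\<lambda>i. f i * g i))" "j < dim_col (E (\<lambda>i. f i * g i))"
    then have ij: "i < n" "j < n"
      by (simp_all add: E_def)
    then have "(E f * E g) $$ (i, j) = (\<Sum>k = 0..<n. E f $$ (i, k) * E g $$ (k, j))"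
      by (simp add: E_def scalar_prod_def)
    also have "\<dots> = (\<Sum>k = 0..<n. if k = i then E f $$ (i, i) * E g $$ (i, j) else 0)"
      using ij by (intro sum.cong) (auto simp: E_def)
    also have "\<dots> = E (\<lambda>i. f i * g i) $$ (i, j)"
      using ij by (simp add: E_def)
    finally show "(E f * E g) $$ (i, j) = E (\<lambda>i. f i * g i) $$ (i, j)" .
  qed (simp_all add: E_def)
  have E': "mat_adjoint (E f) = E f" for f
    by (rule eq_matI) (auto simp: E_def)
  have E1: "E (\<lambda>i. inverse (r i)) * E r = 1\<^sub>m n"
  proof -
    have "inverse (r i) * r i = 1" if "i < n" for i
      using r(1)[OF that] by simp
    then show ?thesis
      unfolding EE by (intro eq_matI) (auto simp: E_def simp del: of_real_mult)
  qed
  have DE: "D = E r * E r * (E r * E r)"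
  proof (rule eq_matI)
    show "D $$ (i, j) = (E r * E r * (E r * E r)) $$ (i, j)"
      if "i < dim_row (E r * E r * (E r * E r))" "j < dim_col (E r * E r * (E r * E r))" for i j
      using that r(2)[of i] D(1,2) unfolding EE by (auto simp: E_def diagonal_mat_def)
  qed (use D E[of r] in auto)
  define C where "C = E r * ?U'"
  have C: "C \<in> carrier_mat n n"
    using E U' by (simp add: C_def)
  have "U * E (\<lambda>i. inverse (r i)) * C = U * (E (\<lambda>i. inverse (r i)) * E r) * ?U'"
    using U U' E by (simp add: C_def)
  also have "\<dots> = 1\<^sub>m n"
    using U U' by (simp add: E1)
  finally have "U * E (\<lambda>i. inverse (r i)) * C = 1\<^sub>m n" .
  then have "posdef_mat n (mat_adjoint C * 1\<^sub>m n * C)"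
    using posdef_mat_congruence[OF posdef_mat_one C] U E by (metis mult_carrier_mat)
  then have "posdef_mat n (mat_adjoint C * C)"
    using C by simp
  moreover have "(mat_adjoint C * C) * (mat_adjoint C * C) = M"
  proof -
    have C': "mat_adjoint C = U * E r"
      using U' E[of r] by (simp add: C_def E' mat_adjoint_mult[of _ n n _ n])
    have cancel: "?U' * (U * Z) = Z" if "Z \<in> carrier_mat n n" for Z
      using assoc_mult_mat[OF U' U(1) that] U(2) that by simp
    have "(mat_adjoint C * C) * (mat_adjoint C * C) = U * D * ?U'"
      unfolding C' DE using U(1) U' E by (simp add: C_def cancel)
    also have "\<dots> = (U * ?U') * M * (U * ?U')"
      unfolding D(3)[symmetric] using U(1) U' m(1) by simp
    also have "\<dots> = M"
      using m(1) by (simp add: U(3))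
    finally show ?thesis .
  qed
  ultimately show thesis
    using that by blast
qed

text \<open>The difference \<open>D = S - T\<close> satisfies \<open>S D + D T = S\<^sup>2 - T\<^sup>2 = 0\<close>. If
  \<open>u\<close> is an eigenvector of the Hermitian matrix \<open>D\<close> for a (real) eigenvalue
  \<open>e\<close>, evaluating this at \<open>u\<close> gives
  \<open>e (\<langle>u, S u\<rangle> + \<langle>u, T u\<rangle>) = 0\<close> with a positive second factor. So every eigenvalue
  of \<open>D\<close> vanishes, and \<open>D = 0\<close> by diagonalisation.\<close>

lemma posdef_mat_sqrt_unique:
  assumes S: "posdef_mat n S" and T: "posdef_mat n T" and eq: "S * S = T * T"
  shows "S = T"
proof -
  note s = posdef_matD[OF S] and t = posdef_matD[OF T]
  note [simp] = assoc_mult_mat[of _ n n _ n _ n]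
  define D where "D = S - T"
  have D: "D \<in> carrier_mat n n" and Dh: "mat_adjoint D = D"
  proof -
    show "D \<in> carrier_mat n n"
      using s t by (simp add: D_def minus_carrier_mat)
    have "mat_adjoint D = mat_adjoint S - mat_adjoint T"
      using s(1) t(1) by (intro eq_matI) (auto simp: D_def)
    then show "mat_adjoint D = D"
      using s t by (simp add: D_def)
  qed
  obtain U E where U: "U \<in> carrier_mat n n" "mat_adjoint U * U = 1\<^sub>m n" "U * mat_adjoint U = 1\<^sub>m n"
    and E: "E \<in> carrier_mat n n" "diagonal_mat E" "mat_adjoint U * D * U = E"
    using hermitian_diagonalization[OF D Dh] by metis
  let ?U' = "mat_adjoint U"
  have U': "?U' \<in> carrier_mat n n"
    using U by simp
  have DU: "D * U = U * E"
  proof -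
    have "U * E = (U * ?U') * (D * U)"
      using U(1) U' D by (simp add: E(3)[symmetric])
    then show ?thesis
      using U(1) D by (simp add: U(3))
  qed
  have "E $$ (i, i) = 0" if i: "i < n" for i
  proof (rule ccontr)
    assume nz: "E $$ (i, i) \<noteq> 0"
    define u where "u = col U i"
    let ?e = "E $$ (i, i)"
    have u: "u \<in> carrier_vec n"
      using U by (simp add: u_def col_dim carrier_vecI)
    have "col E i = ?e \<cdot>\<^sub>v unit_vec n i"
      using E i by (intro eq_vecI) (auto simp: diagonal_mat_def)
    then have Du: "D *\<^sub>v u = ?e \<cdot>\<^sub>v u"
      using arg_cong[OF DU, of "\<lambda>X. col X i"] i mult_mat_vec[OF U(1), of "unit_vec n i" ?e]
      unfolding u_def col_mult2[OF D U(1) i] col_mult2[OF U(1) E(1) i]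
      by (simp add: mult_unit_vec_col[OF U(1) i])
    have un: "u \<noteq> 0\<^sub>v n"
    proof
      assume "u = 0\<^sub>v n"
      then have "col (?U' * U) i = 0\<^sub>v n"
        using U U' i by (subst col_mult2[of _ n n _ n]) (auto simp: u_def)
      then show False
        using i U(2) by simp
    qed
    have "S * D + D * T = 0\<^sub>m n n"
    proof -
      have "S * D + D * T = (S * S - S * T) + (S * T - T * T)"
        using s t by (simp add: D_def mult_minus_distrib_mat minus_mult_distrib_mat)
      also have "\<dots> = 0\<^sub>m n n"
        using s(1) t(1) by (intro eq_matI) (auto simp: eq)
      finally show ?thesis .
    qed
    then have "0 = ((S * D + D * T) *\<^sub>v u) \<bullet>c u"
      using u by (simp add: scalar_prod_def)
    also have "\<dots> = (S *\<^sub>v (D *\<^sub>v u)) \<bullet>c u + (D *\<^sub>v (T *\<^sub>v u)) \<bullet>c u"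
      using s t D u
      by (subst add_mult_distrib_mat_vec[of _ n n])
         (auto simp: add_scalar_prod_distrib[of _ n] assoc_mult_mat_vec[of _ n n _ n])
    also have "(D *\<^sub>v (T *\<^sub>v u)) \<bullet>c u = (T *\<^sub>v u) \<bullet>c (D *\<^sub>v u)"
      using cscalar_prod_mat_adjoint[OF D, of "T *\<^sub>v u" u] t u by (simp add: Dh)
    also have "(S *\<^sub>v (D *\<^sub>v u)) \<bullet>c u = ?e * ((S *\<^sub>v u) \<bullet>c u)"
      using s u by (simp add: Du mult_mat_vec[of _ n n] )
    also have "(T *\<^sub>v u) \<bullet>c (D *\<^sub>v u) = ?e * ((T *\<^sub>v u) \<bullet>c u)"
    proof -
      have "cnj ?e = ?e"
      proof -
        have "?e * (u \<bullet>c u) = cnj ?e * (u \<bullet>c u)"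
          using cscalar_prod_mat_adjoint[OF D u u] u by (simp add: Dh Du conjugate_smult_vec)
        moreover have "u \<bullet>c u \<noteq> 0"
          using u un by simp
        ultimately show ?thesis
          by simp
      qed
      then show ?thesis
        using t u by (simp add: Du conjugate_smult_vec)
    qed
    finally have "(S *\<^sub>v u) \<bullet>c u + (T *\<^sub>v u) \<bullet>c u = 0"
      using nz by (metis distrib_left mult_eq_0_iff)
    moreover have "0 < (S *\<^sub>v u) \<bullet>c u + (T *\<^sub>v u) \<bullet>c u"
      using s(3)[OF u un] t(3)[OF u un] by (rule add_pos_pos)
    ultimately show False
      by simp
  qed
  then have "E = 0\<^sub>m n n"
    using E by (intro eq_matI) (auto simp: diagonal_mat_def)
  then have "D * U * ?U' = 0\<^sub>m n n"
    using U U' by (simp add: DU)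
  then have "D = 0\<^sub>m n n"
    using U U' D by simp
  show ?thesis
  proof (rule eq_matI)
    fix i j assume ij: "i < dim_row T" "j < dim_col T"
    have "(S - T) $$ (i, j) = 0"
      using \<open>D = 0\<^sub>m n n\<close> ij t(1) by (simp add: D_def)
    then show "S $$ (i, j) = T $$ (i, j)"
      using ij by simp
  qed (use s t in auto)
qed

section \<open>Geometric means in a monoid with involution\<close>

text \<open>The model is the algebra of complex matrices with \<open>star\<close> the adjoint and
  \<open>P\<close> the positive definite matrices. The axioms are purely multiplicative, so that an
  instance can be transported along a multiplicative embedding.\<close>

locale involutive_cone = monoid G for G (structure) +
  fixes star :: "'a \<Rightarrow> 'a" and P :: "'a set"
  assumes star_closed [simp]: "x \<in> carrier G \<Longrightarrow> star x \<in> carrier G"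
    and star_mult: "x \<in> carrier G \<Longrightarrow> y \<in> carrier G \<Longrightarrow> star (x \<otimes> y) = star y \<otimes> star x"
    and star_one: "star \<one> = \<one>"
    and cone_Units: "x \<in> P \<Longrightarrow> x \<in> Units G"
    and cone_star: "x \<in> P \<Longrightarrow> star x = x"
    and cone_congruence: "c \<in> Units G \<Longrightarrow> x \<in> P \<Longrightarrow> star c \<otimes> x \<otimes> c \<in> P"
    and cone_sqrt_ex1: "x \<in> P \<Longrightarrow> \<exists>!s. s \<in> P \<and> s \<otimes> s = x"
begin

definition psqrt :: "'a \<Rightarrow> 'a" where
  "psqrt x = (THE s. s \<in> P \<and> s \<otimes> s = x)"

definition gmean :: "'a \<Rightarrow> 'a \<Rightarrow> 'a" where
  "gmean a b = psqrt a \<otimes> psqrt (inv (psqrt a) \<otimes> b \<otimes> inv (psqrt a)) \<otimes> psqrt a"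

lemma cone_carrier: "x \<in> P \<Longrightarrow> x \<in> carrier G"
  by (simp add: Units_closed cone_Units)

lemma psqrt_cone: "x \<in> P \<Longrightarrow> psqrt x \<in> P"
  and psqrt_square: "x \<in> P \<Longrightarrow> psqrt x \<otimes> psqrt x = x"
  unfolding psqrt_def using theI'[OF cone_sqrt_ex1, of x] by simp_all

lemma psqrt_unique: "s \<in> P \<Longrightarrow> s \<otimes> s = x \<Longrightarrow> x \<in> P \<Longrightarrow> psqrt x = s"
  unfolding psqrt_def by (rule the1_equality[OF cone_sqrt_ex1]) simp_all

lemma inv_mult_cancel:
  assumes "x \<in> Units G" "z \<in> carrier G"
  shows "inv x \<otimes> (x \<otimes> z) = z" "x \<otimes> (inv x \<otimes> z) = z"
  using assms by (simp_all add: Units_closed flip: m_assoc)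

lemma star_inv:
  assumes "c \<in> Units G"
  shows "star c \<in> Units G" "inv (star c) = star (inv c)"
proof -
  have 1: "star (inv c) \<otimes> star c = \<one>" "star c \<otimes> star (inv c) = \<one>"
    using assms by (simp_all add: Units_closed star_one flip: star_mult)
  then show u: "star c \<in> Units G"
    unfolding Units_def mem_Collect_eq
    using star_closed[OF Units_inv_closed[OF assms]] star_closed[OF Units_closed[OF assms]] by blast
  show "inv (star c) = star (inv c)"
    using assms 1 by (intro inv_unique'[symmetric]) (simp_all add: Units_closed)
qed

lemma inv_mult_Units:
  assumes "x \<in> Units G" "y \<in> Units G"
  shows "inv (x \<otimes> y) = inv y \<otimes> inv x"
  using assms
  by (intro inv_unique'[symmetric]) (simp_all add: Units_closed m_assoc inv_mult_cancel)

text \<open>The inverse of a selfadjoint \<open>x\<close> is the congruence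
  \<open>(x\<^sup>-\<^sup>1)\<^sup>* x x\<^sup>-\<^sup>1\<close> of \<open>x\<close>.\<close>

lemma inv_cone:
  assumes "x \<in> P"
  shows "inv x \<in> P"
proof -
  have x: "x \<in> Units G" "star (inv x) = inv x"
    using assms cone_Units star_inv(2)[of x] cone_star by auto
  then have "inv x \<otimes> x \<otimes> inv x \<in> P"
    using cone_congruence[of "inv x" x] assms by simp
  then show ?thesis
    using x by (simp add: Units_closed)
qed

lemma cone_congruence_self:
  "c \<in> P \<Longrightarrow> x \<in> P \<Longrightarrow> c \<otimes> x \<otimes> c \<in> P"
  using cone_congruence[of c x] by (simp add: cone_Units cone_star)

lemma gmean_cone:
  assumes "a \<in> P" "b \<in> P"
  shows "gmean a b \<in> P"
  unfolding gmean_def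
  using assms by (intro cone_congruence_self psqrt_cone inv_cone)

lemma gmean_riccati:
  assumes a: "a \<in> P" and b: "b \<in> P"
  shows "gmean a b \<otimes> inv a \<otimes> gmean a b = b"
proof -
  define r where "r = psqrt a"
  define m where "m = inv r \<otimes> b \<otimes> inv r"
  have rP: "r \<in> P" and rr: "r \<otimes> r = a"
    using a by (simp_all add: r_def psqrt_cone psqrt_square)
  have mP: "m \<in> P"
    unfolding m_def using rP b by (intro cone_congruence_self inv_cone)
  have r: "r \<in> Units G" "r \<in> carrier G" and bc: "b \<in> carrier G"
    and s: "psqrt m \<in> carrier G" "psqrt m \<otimes> psqrt m = m"
    using rP mP b by (simp_all add: cone_Units cone_carrier psqrt_cone psqrt_square)
  have "gmean a b \<otimes> inv a \<otimes> gmean a b = r \<otimes> psqrt m \<otimes> r \<otimes> (inv r \<otimes> inv r) \<otimes> (r \<otimes> psqrt m \<otimes> r)"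
    unfolding gmean_def r_def[symmetric] m_def[symmetric]
    using r inv_mult_Units[of r r] by (simp add: rr)
  also have "\<dots> = r \<otimes> (psqrt m \<otimes> psqrt m) \<otimes> r"
    using r s(1) by (simp add: m_assoc inv_mult_cancel)
  also have "\<dots> = b"
    using r bc unfolding s(2) by (simp add: m_def m_assoc inv_mult_cancel)
  finally show ?thesis .
qed

text \<open>Together with \<open>gmean_riccati\<close> this characterises the mean. Dividing the equation by
  the square root \<open>r\<close> of \<open>a\<close> on both sides turns it into
  \<open>(r\<^sup>-\<^sup>1 g r\<^sup>-\<^sup>1)\<^sup>2 = r\<^sup>-\<^sup>1 b r\<^sup>-\<^sup>1\<close>, which determines \<open>g\<close>.\<close>

lemma gmean_unique:
  assumes a: "a \<in> P" and g: "g \<in> P" and b: "b \<in> P" and eq: "g \<otimes> inv a \<otimes> g = b"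
  shows "gmean a b = g"
proof -
  define r where "r = psqrt a"
  have rP: "r \<in> P" and rr: "r \<otimes> r = a"
    using a by (simp_all add: r_def psqrt_cone psqrt_square)
  have r: "r \<in> Units G" "r \<in> carrier G" and gc: "g \<in> carrier G"
    using rP g by (simp_all add: cone_Units cone_carrier)
  have "(inv r \<otimes> g \<otimes> inv r) \<otimes> (inv r \<otimes> g \<otimes> inv r) = inv r \<otimes> (g \<otimes> inv a \<otimes> g) \<otimes> inv r"
    using r gc by (simp add: m_assoc inv_mult_Units flip: rr)
  then have "psqrt (inv r \<otimes> b \<otimes> inv r) = inv r \<otimes> g \<otimes> inv r"
    unfolding eq using rP g b by (intro psqrt_unique cone_congruence_self inv_cone)
  then show ?thesis
    using r gc by (simp add: gmean_def r_def[symmetric] m_assoc inv_mult_cancel)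
qed

lemma gmean_idem:
  assumes "a \<in> P"
  shows "gmean a a = a"
  using assms by (intro gmean_unique) (auto simp: cone_Units cone_carrier)

text \<open>The Riccati equation \<open>g a\<^sup>-\<^sup>1 g = b\<close> is symmetric in its data: solved for
  \<open>a\<close> it reads \<open>g b\<^sup>-\<^sup>1 g = a\<close>.\<close>

lemma gmean_commute:
  assumes a: "a \<in> P" and b: "b \<in> P"
  shows "gmean a b = gmean b a"
proof -
  let ?g = "gmean a b"
  have g: "?g \<in> P"
    using a b by (rule gmean_cone)
  have u: "a \<in> Units G" "?g \<in> Units G" "a \<in> carrier G" "?g \<in> carrier G"
    using a g by (simp_all add: cone_Units cone_carrier)
  have "inv b = inv (?g \<otimes> (inv a \<otimes> ?g))"
    using gmean_riccati[OF a b] u by (simp add: m_assoc)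
  also have "\<dots> = inv ?g \<otimes> a \<otimes> inv ?g"
    using u by (simp add: inv_mult_Units)
  finally have "?g \<otimes> inv b \<otimes> ?g = a"
    using u by (simp add: m_assoc inv_mult_cancel)
  then show ?thesis
    using gmean_unique[OF b g a] by simp
qed

text \<open>Inverting \<open>g a\<^sup>-\<^sup>1 g = b\<close> gives \<open>g\<^sup>-\<^sup>1 a g\<^sup>-\<^sup>1 = b\<^sup>-\<^sup>1\<close>, the
  equation of the mean of the inverses.\<close>

lemma inv_gmean:
  assumes a: "a \<in> P" and b: "b \<in> P"
  shows "inv (gmean a b) = gmean (inv a) (inv b)"
proof -
  let ?g = "gmean a b"
  have g: "?g \<in> P"
    using a b by (rule gmean_cone)
  have u: "a \<in> Units G" "?g \<in> Units G" "a \<in> carrier G" "?g \<in> carrier G"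
    using a g by (simp_all add: cone_Units cone_carrier)
  have "inv b = inv (?g \<otimes> (inv a \<otimes> ?g))"
    using gmean_riccati[OF a b] u by (simp add: m_assoc)
  also have "\<dots> = inv ?g \<otimes> inv (inv a) \<otimes> inv ?g"
    using u by (simp add: inv_mult_Units)
  finally have "gmean (inv a) (inv b) = inv ?g"
    by (intro gmean_unique inv_cone a b g) (rule sym)
  then show ?thesis ..
qed

text \<open>With \<open>d = c\<^sup>*\<close>, the factors \<open>c\<close> and \<open>d\<close> cancel against
  \<open>(d a c)\<^sup>-\<^sup>1 = c\<^sup>-\<^sup>1 a\<^sup>-\<^sup>1 d\<^sup>-\<^sup>1\<close> in the equation of the transformed mean.\<close>

lemma gmean_congruence:
  assumes c: "c \<in> Units G" and a: "a \<in> P" and b: "b \<in> P"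
  shows "gmean (star c \<otimes> a \<otimes> c) (star c \<otimes> b \<otimes> c) = star c \<otimes> gmean a b \<otimes> c"
proof -
  let ?g = "gmean a b" and ?d = "star c"
  have g: "?g \<in> P"
    using a b by (rule gmean_cone)
  have u: "a \<in> Units G" "a \<in> carrier G" "?g \<in> carrier G" "c \<in> carrier G" "?d \<in> Units G" "?d \<in> carrier G"
    using a g c star_inv(1)[OF c] by (simp_all add: cone_Units cone_carrier Units_closed)
  have "inv (?d \<otimes> a \<otimes> c) = inv c \<otimes> (inv a \<otimes> inv ?d)"
    using u c by (simp add: inv_mult_Units)
  then have "(?d \<otimes> ?g \<otimes> c) \<otimes> inv (?d \<otimes> a \<otimes> c) \<otimes> (?d \<otimes> ?g \<otimes> c) = ?d \<otimes> (?g \<otimes> inv a \<otimes> ?g) \<otimes> c"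
    using u c by (simp add: m_assoc inv_mult_cancel)
  then show ?thesis
    using a b c g by (intro gmean_unique cone_congruence) (simp_all add: gmean_riccati)
qed

end

section \<open>Block circulant matrices\<close>

lemma block_shift_mod:
  "(r + k * n) mod (n * p) = n * ((r div n + k) mod p) + r mod n" for n :: nat
  by (cases "n = 0") (simp_all add: mod_mult2_eq add.commute)

lemma mod_less_bound: "r < N \<Longrightarrow> s mod N < N" for r s N :: nat
  by (cases N) simp_all

lemma block_index:
  fixes r n p :: nat
  assumes "r < n * p"
  shows "r div n < p" "r mod n < n"
  using assms by (auto simp: less_mult_imp_div_less mult.commute gr0_conv_Suc elim: less_natE
      intro!: mod_less_divisor gr0I)

lemma block_index_less:
  fixes i k n p :: nat
  assumes "i < n" "k < p"
  shows "k * n + i < n * p"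
proof -
  have "k * n + i < Suc k * n"
    using assms by simp
  also have "\<dots> \<le> p * n"
    using assms by (intro mult_le_mono1) simp
  finally show ?thesis
    by (simp add: mult.commute)
qed

text \<open>The permutation matrix that sends each standard basis vector to the one at the same
  position of the next block, cyclically.\<close>

definition block_shift :: "nat \<Rightarrow> nat \<Rightarrow> complex mat" where
  "block_shift n p = mat (n * p) (n * p) (\<lambda>(r, c). if r = (c + n) mod (n * p) then 1 else 0)"

text \<open>Block circulance as invariance under an automorphism, rather than as a pattern of entries,
  makes closure under products and adjoints immediate and reduces closure under
  inverses and square roots to their uniqueness.\<close>

definition block_circulant :: "nat \<Rightarrow> nat \<Rightarrow> complex mat set" where
  "block_circulant n p =
     {M \<in> carrier_mat (n * p) (n * p). mat_adjoint (block_shift n p) * M * block_shift n p = M}"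

lemma block_shift_carrier: "block_shift n p \<in> carrier_mat (n * p) (n * p)"
  by (simp add: block_shift_def)

lemma mult_block_shift:
  assumes M: "M \<in> carrier_mat m (n * p)" and r: "r < m" and c: "c < n * p"
  shows "(M * block_shift n p) $$ (r, c) = M $$ (r, (c + n) mod (n * p))"
proof -
  let ?c = "(c + n) mod (n * p)"
  have "?c < n * p"
    using c by (rule mod_less_bound)
  have "(M * block_shift n p) $$ (r, c) = (\<Sum>k = 0..<n * p. M $$ (r, k) * block_shift n p $$ (k, c))"
    using assms by (simp add: scalar_prod_def block_shift_def)
  also have "\<dots> = (\<Sum>k = 0..<n * p. if k = ?c then M $$ (r, ?c) else 0)"
    using c by (intro sum.cong) (simp_all add: block_shift_def)
  also have "\<dots> = M $$ (r, ?c)"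
    using \<open>?c < n * p\<close> by simp
  finally show ?thesis .
qed

lemma shift_conjugation:
  assumes M: "M \<in> carrier_mat (n * p) (n * p)" and r: "r < n * p" and c: "c < n * p"
  shows "(mat_adjoint (block_shift n p) * M * block_shift n p) $$ (r, c) =
    M $$ ((r + n) mod (n * p), (c + n) mod (n * p))"
proof -
  let ?Q = "block_shift n p" and ?N = "n * p"
  have Q: "?Q \<in> carrier_mat ?N ?N" "mat_adjoint ?Q \<in> carrier_mat ?N ?N"
    by (simp_all add: block_shift_carrier)
  have rc: "(r + n) mod ?N < ?N" "(c + n) mod ?N < ?N"
    using r by (simp_all add: mod_less_bound[OF r])
  have "mat_adjoint ?Q * M = mat_adjoint (mat_adjoint M * ?Q)"
    using Q M by (simp add: mat_adjoint_mult[of _ ?N ?N _ ?N])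
  then have "(mat_adjoint ?Q * M) $$ (r, s) = M $$ ((r + n) mod ?N, s)" if "s < ?N" for s
    using Q M r that rc mult_block_shift[of "mat_adjoint M" ?N n p s r] by simp
  moreover have "(mat_adjoint ?Q * M * ?Q) $$ (r, c) = (mat_adjoint ?Q * M) $$ (r, (c + n) mod ?N)"
    using Q M r c by (intro mult_block_shift[of _ ?N]) simp_all
  ultimately show ?thesis
    using rc by simp
qed

lemma block_shift_unitary:
  "mat_adjoint (block_shift n p) * block_shift n p = 1\<^sub>m (n * p)"
  "block_shift n p * mat_adjoint (block_shift n p) = 1\<^sub>m (n * p)"
proof -
  let ?Q = "block_shift n p" and ?N = "n * p"
  have Q: "?Q \<in> carrier_mat ?N ?N"
    by (rule block_shift_carrier)
  have "mat_adjoint ?Q * 1\<^sub>m ?N * ?Q = 1\<^sub>m ?N"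
  proof (rule eq_matI)
    fix r c assume "r < dim_row (1\<^sub>m ?N :: complex mat)" "c < dim_col (1\<^sub>m ?N :: complex mat)"
    then have rc: "r < ?N" "c < ?N"
      by simp_all
    then have less: "(r + n) mod ?N < ?N" "(c + n) mod ?N < ?N"
      by (simp_all add: mod_less_bound[OF rc(1)])
    \<comment> \<open>Shifting by the other \<open>p - 1\<close> blocks undoes the shift, which is therefore injective.\<close>
    have "((s + n) mod ?N + (p - 1) * n) mod ?N = s" if "s < ?N" for s
    proof -
      have "s + n + (p - 1) * n = s + ?N"
        using that by (cases p) (simp_all add: algebra_simps)
      then show ?thesis
        using that by (simp only: mod_add_left_eq mod_add_self2 mod_less)
    qed
    then have "r = c" if "(r + n) mod ?N = (c + n) mod ?N"
      using that rc by metis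
    then show "(mat_adjoint ?Q * 1\<^sub>m ?N * ?Q) $$ (r, c) = 1\<^sub>m ?N $$ (r, c)"
      using rc less by (subst shift_conjugation) auto
  qed (use Q in simp_all)
  then show "mat_adjoint ?Q * ?Q = 1\<^sub>m ?N"
    using Q by simp
  then show "?Q * mat_adjoint ?Q = 1\<^sub>m ?N"
    using mat_mult_left_right_inverse[of "mat_adjoint ?Q" ?N ?Q] Q by simp
qed

lemma shift_conjugation_mult:
  assumes "M \<in> carrier_mat (n * p) (n * p)" "N \<in> carrier_mat (n * p) (n * p)"
  shows "mat_adjoint (block_shift n p) * (M * N) * block_shift n p =
    (mat_adjoint (block_shift n p) * M * block_shift n p) *
    (mat_adjoint (block_shift n p) * N * block_shift n p)"
proof -
  let ?Q = "block_shift n p" and ?N = "n * p"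
  note [simp] = assoc_mult_mat[of _ ?N ?N _ ?N _ ?N]
  have Q: "?Q \<in> carrier_mat ?N ?N" "mat_adjoint ?Q \<in> carrier_mat ?N ?N"
    by (simp_all add: block_shift_carrier)
  have "?Q * (mat_adjoint ?Q * (N * ?Q)) = N * ?Q"
    using assms Q assoc_mult_mat[of ?Q ?N ?N "mat_adjoint ?Q" ?N "N * ?Q" ?N]
    by (simp add: block_shift_unitary)
  then show ?thesis
    using assms Q by simp
qed

lemma block_circulantD:
  assumes "M \<in> block_circulant n p"
  shows "M \<in> carrier_mat (n * p) (n * p)"
    "mat_adjoint (block_shift n p) * M * block_shift n p = M"
  using assms by (simp_all add: block_circulant_def)

lemma block_circulant_mult:
  assumes "M \<in> block_circulant n p" "N \<in> block_circulant n p"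
  shows "M * N \<in> block_circulant n p"
  using block_circulantD[OF assms(1)] block_circulantD[OF assms(2)]
  by (simp add: block_circulant_def shift_conjugation_mult del: assoc_mult_mat)

lemma block_circulant_one: "1\<^sub>m (n * p) \<in> block_circulant n p"
  using block_shift_carrier[of n p] by (simp add: block_circulant_def block_shift_unitary)

lemma block_circulant_adjoint:
  assumes "M \<in> block_circulant n p"
  shows "mat_adjoint M \<in> block_circulant n p"
proof -
  let ?Q = "block_shift n p" and ?N = "n * p"
  have Q: "?Q \<in> carrier_mat ?N ?N"
    by (rule block_shift_carrier)
  note M = block_circulantD[OF assms]
  have "mat_adjoint (mat_adjoint ?Q * M * ?Q) = mat_adjoint ?Q * mat_adjoint M * ?Q"
    using Q M(1) by (simp add: mat_adjoint_mult[of _ ?N ?N _ ?N] assoc_mult_mat[of _ ?N ?N _ ?N _ ?N])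
  then show ?thesis
    using M by (simp add: block_circulant_def)
qed

lemma block_circulant_inverse:
  assumes M: "M \<in> block_circulant n p" and X: "X \<in> carrier_mat (n * p) (n * p)"
    and MX: "M * X = 1\<^sub>m (n * p)" and XM: "X * M = 1\<^sub>m (n * p)"
  shows "X \<in> block_circulant n p"
proof -
  let ?Q = "block_shift n p" and ?N = "n * p"
  let ?X = "mat_adjoint ?Q * X * ?Q"
  have Q: "?Q \<in> carrier_mat ?N ?N"
    by (rule block_shift_carrier)
  note m = block_circulantD[OF M]
  have X': "?X \<in> carrier_mat ?N ?N"
    using Q X by simp
  have "M * ?X = mat_adjoint ?Q * (M * X) * ?Q"
    unfolding shift_conjugation_mult[OF m(1) X] m(2) ..
  also have "\<dots> = 1\<^sub>m ?N"
    using block_circulantD(2)[OF block_circulant_one] by (simp add: MX)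
  finally have "M * ?X = 1\<^sub>m ?N" .
  then have "?X = X"
    using assoc_mult_mat[OF X m(1) X'] X left_mult_one_mat[OF X'] by (simp only: XM right_mult_one_mat)
  then show ?thesis
    using X by (simp add: block_circulant_def)
qed

text \<open>Conjugation by the unitary shift turns \<open>S\<close> into a positive definite square root of the
  same matrix \<open>S\<^sup>2\<close>, which has only one.\<close>

lemma block_circulant_sqrt:
  assumes M: "S * S \<in> block_circulant n p" and S: "posdef_mat (n * p) S"
  shows "S \<in> block_circulant n p"
proof -
  let ?Q = "block_shift n p" and ?N = "n * p"
  have Q: "?Q \<in> carrier_mat ?N ?N" "mat_adjoint ?Q \<in> carrier_mat ?N ?N"
    by (simp_all add: block_shift_carrier)
  note s = posdef_matD(1)[OF S]
  have "posdef_mat ?N (mat_adjoint ?Q * S * ?Q)"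
    using posdef_mat_congruence[OF S Q block_shift_unitary(1)] .
  moreover have "(mat_adjoint ?Q * S * ?Q) * (mat_adjoint ?Q * S * ?Q) = S * S"
    unfolding shift_conjugation_mult[OF s s, symmetric] by (rule block_circulantD(2)[OF M])
  ultimately have "mat_adjoint ?Q * S * ?Q = S"
    using posdef_mat_sqrt_unique S by blast
  then show ?thesis
    using s by (simp add: block_circulant_def)
qed

lemma block_circulant_index_shift:
  assumes M: "M \<in> block_circulant n p" and rc: "r < n * p" "c < n * p"
  shows "M $$ ((r + k * n) mod (n * p), (c + k * n) mod (n * p)) = M $$ (r, c)"
proof (induction k)
  case 0
  then show ?case
    using rc by simp
next
  case (Suc k)
  let ?r = "(r + k * n) mod (n * p)" and ?c = "(c + k * n) mod (n * p)"
  have less: "?r < n * p" "?c < n * p"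
    by (simp_all add: mod_less_bound[OF rc(1)])
  have "M $$ (?r, ?c) = M $$ ((?r + n) mod (n * p), (?c + n) mod (n * p))"
    using shift_conjugation[OF _ less, of M] block_circulantD[OF M] by simp
  moreover have "((s + k * n) mod (n * p) + n) mod (n * p) = (s + Suc k * n) mod (n * p)" for s
    by (simp only: mod_add_left_eq) (simp add: add_ac)
  ultimately show ?case
    using Suc.IH by simp
qed

text \<open>Shifting by \<open>p - c div n\<close> blocks moves column \<open>c\<close> into block column
  \<open>0\<close>, so a block circulant matrix is determined by its first block column.\<close>

lemma block_circulant_index:
  assumes M: "M \<in> block_circulant n p" and r: "r < n * p" and c: "c < n * p"
  shows "M $$ (r, c) = M $$ (((p + r div n - c div n) mod p) * n + r mod n, c mod n)"
proof -
  let ?k = "p - c div n"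
  have cn: "c div n < p"
    using block_index(1)[OF c] .
  then have "r div n + ?k = p + r div n - c div n" "c div n + ?k = p"
    by simp_all
  then show ?thesis
    using block_circulant_index_shift[OF M r c, of ?k]
    unfolding block_shift_mod by (simp add: mult.commute)
qed

section \<open>Tensors as block circulant matrices\<close>

lemma tensorsD:
  assumes "A \<in> tensors m n p"
  shows "length A = p" "k < p \<Longrightarrow> A ! k \<in> carrier_mat m n"
    "0 < p \<Longrightarrow> trows A = m" "0 < p \<Longrightarrow> tcols A = n"
  using assms by (auto simp: tensors_def trows_def tcols_def)

lemma tensor_eqI:
  assumes "A \<in> tensors m n p" "B \<in> tensors m n p"
    and "\<And>k i j. k < p \<Longrightarrow> i < m \<Longrightarrow> j < n \<Longrightarrow> A ! k $$ (i, j) = B ! k $$ (i, j)"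
  shows "A = B"
proof (rule nth_equalityI)
  show "length A = length B"
    using assms(1,2) by (simp add: tensors_def)
  fix k assume "k < length A"
  then have "k < p"
    using assms(1) by (simp add: tensors_def)
  then show "A ! k = B ! k"
    using tensorsD(2)[OF assms(1), of k] tensorsD(2)[OF assms(2), of k] assms(3)
    by (intro eq_matI) auto
qed

definition first_block_column :: "nat \<Rightarrow> nat \<Rightarrow> complex mat \<Rightarrow> tensor" where
  "first_block_column n p M = map (\<lambda>k. mat n n (\<lambda>(i, j). M $$ (k * n + i, j))) [0..<p]"

lemma first_block_column_tensors: "first_block_column n p M \<in> tensors n n p"
  by (simp add: first_block_column_def tensors_def)

lemma sum_blocks:
  fixes f :: "nat \<Rightarrow> 'a :: comm_monoid_add"
  shows "(\<Sum>r<n * p. f r) = (\<Sum>i<n. \<Sum>k<p. f (k * n + i))"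
proof -
  have "(\<Sum>i<n. \<Sum>k<p. f (k * n + i)) = (\<Sum>k<p. \<Sum>i<n. f (k * n + i))"
    by (rule sum.swap)
  also have "\<dots> = (\<Sum>k<p. sum f {k * n..<k * n + n})"
  proof (rule sum.cong[OF refl])
    fix k
    show "(\<Sum>i<n. f (k * n + i)) = sum f {k * n..<k * n + n}"
      using sum.shift_bounds_nat_ivl[of f 0 "k * n" n]
      by (simp add: atLeast0LessThan add.commute)
  qed
  also have "\<dots> = (\<Sum>r<p * n. f r)"
    by (rule sum.nat_group)
  finally show ?thesis
    by (simp add: mult.commute)
qed

context
  fixes n p :: nat
  assumes p: "0 < p"
begin

lemma bcirc_carrier: "A \<in> tensors n n p \<Longrightarrow> bcirc A \<in> carrier_mat (n * p) (n * p)"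
  using p by (simp add: bcirc_def tensorsD Let_def)

lemma bcirc_index:
  assumes "A \<in> tensors n n p" "r < n * p" "c < n * p"
  shows "bcirc A $$ (r, c) = A ! ((p + r div n - c div n) mod p) $$ (r mod n, c mod n)"
  using assms p by (simp add: bcirc_def tensorsD Let_def)

lemma bcirc_index_first_column:
  assumes "A \<in> tensors n n p" "k < p" "i < n" "j < n"
  shows "bcirc A $$ (k * n + i, j) = A ! k $$ (i, j)"
proof -
  have "j < n * p"
    using assms block_index_less[of j n 0 p] p by simp
  then show ?thesis
    using assms by (subst bcirc_index) (simp_all add: block_index_less)
qed

lemma bcirc_block_circulant:
  assumes A: "A \<in> tensors n n p"
  shows "bcirc A \<in> block_circulant n p"
proof -
  let ?Q = "block_shift n p" and ?N = "n * p"
  note Ac = bcirc_carrier[OF A]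
  have "mat_adjoint ?Q * bcirc A * ?Q = bcirc A"
  proof (rule eq_matI)
    fix r c assume "r < dim_row (bcirc A)" "c < dim_col (bcirc A)"
    then have rc: "r < ?N" "c < ?N"
      using Ac by simp_all
    then have "0 < n"
      by (auto intro: gr0I)
    have less: "(r + n) mod ?N < ?N" "(c + n) mod ?N < ?N"
      by (simp_all add: mod_less_bound[OF rc(1)])
    have shift: "(s + n) mod ?N div n = (s div n + 1) mod p" "(s + n) mod ?N mod n = s mod n" for s
      using block_shift_mod[of s 1 n p] \<open>0 < n\<close> by simp_all
    have "(p + (a + 1) mod p - (b + 1) mod p) mod p = (p + a - b) mod p"
      if "a < p" "b < p" for a b
    proof (cases "Suc a = p")
      case True
      then have "p + a - b = (a - b) + p"
        using that by simp
      then have "(p + a - b) mod p = a - b"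
        using that by (simp only: mod_add_self2) simp
      then show ?thesis
        using that True by (auto simp: mod_Suc)
    next
      case False
      then show ?thesis
        using that by (auto simp: mod_Suc)
    qed
    then have idx: "(p + (r div n + 1) mod p - (c div n + 1) mod p) mod p = (p + r div n - c div n) mod p"
      using block_index(1)[OF rc(1)] block_index(1)[OF rc(2)] by blast
    show "(mat_adjoint ?Q * bcirc A * ?Q) $$ (r, c) = bcirc A $$ (r, c)"
      unfolding shift_conjugation[OF Ac rc] bcirc_index[OF A rc] bcirc_index[OF A less] shift idx ..
  qed (use Ac block_shift_carrier[of n p] in auto)
  then show ?thesis
    using Ac by (simp add: block_circulant_def)
qed

lemma first_block_column_bcirc:
  assumes "A \<in> tensors n n p"
  shows "first_block_column n p (bcirc A) = A"
  using assms
  by (intro tensor_eqI[OF first_block_column_tensors])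
     (auto simp: first_block_column_def bcirc_index_first_column)

lemma bcirc_inject:
  "A \<in> tensors n n p \<Longrightarrow> B \<in> tensors n n p \<Longrightarrow> bcirc A = bcirc B \<Longrightarrow> A = B"
  using first_block_column_bcirc by metis

lemma bcirc_first_block_column:
  assumes M: "M \<in> block_circulant n p"
  shows "bcirc (first_block_column n p M) = M"
proof (rule eq_matI)
  note m = block_circulantD(1)[OF M]
  note T = first_block_column_tensors[of n p M]
  fix r c assume "r < dim_row M" "c < dim_col M"
  then have rc: "r < n * p" "c < n * p"
    using m by simp_all
  have "(p + r div n - c div n) mod p < p"
    using p by simp
  then show "bcirc (first_block_column n p M) $$ (r, c) = M $$ (r, c)"
    unfolding bcirc_index[OF T rc] block_circulant_index[OF M rc]
    using block_index(2)[OF rc(1)] block_index(2)[OF rc(2)] by (simp add: first_block_column_def)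
qed (use bcirc_carrier[OF first_block_column_tensors, of M] block_circulantD(1)[OF M] in auto)

lemma tprod_tensors:
  assumes "A \<in> tensors n n p" "B \<in> tensors n m p"
  shows "A *\<^sub>T B \<in> tensors n m p"
  using tensorsD[OF assms(1)] tensorsD[OF assms(2)] p
  by (simp add: tprod_def tfold_def tunfold_def tensors_def Let_def)

lemma tprod_index:
  assumes A: "A \<in> tensors n n p" and B: "B \<in> tensors n m p" and k: "k < p" "i < n" "j < m"
  shows "(A *\<^sub>T B) ! k $$ (i, j) =
    (\<Sum>r<n * p. bcirc A $$ (k * n + i, r) * B ! (r div n) $$ (r mod n, j))"
  using bcirc_carrier[OF A] k p block_index_less[OF k(2,1)]
  by (auto simp: tprod_def tfold_def tunfold_def tensorsD[OF A] tensorsD[OF B] Let_def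
      scalar_prod_def atLeast0LessThan intro!: sum.cong)

text \<open>The first block column of \<open>bcirc A * bcirc B\<close> is \<open>bcirc A\<close> times the first
  block column of \<open>bcirc B\<close>, which is \<open>tunfold B\<close>. So the T-product consists of the
  blocks in the first block column of a block circulant matrix.\<close>

lemma bcirc_tprod:
  assumes A: "A \<in> tensors n n p" and B: "B \<in> tensors n n p"
  shows "bcirc (A *\<^sub>T B) = bcirc A * bcirc B"
proof -
  have "A *\<^sub>T B = first_block_column n p (bcirc A * bcirc B)"
  proof (rule tensor_eqI[OF tprod_tensors[OF A B] first_block_column_tensors])
    fix k i j assume kij: "k < p" "i < n" "j < n"
    have j: "j < n * p"
      using block_index_less[of j n 0 p] kij p by simp
    have "bcirc B $$ (r, j) = B ! (r div n) $$ (r mod n, j)" if "r < n * p" for r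
      using bcirc_index[OF B that j] kij block_index(1)[OF that] by simp
    then show "(A *\<^sub>T B) ! k $$ (i, j) = first_block_column n p (bcirc A * bcirc B) ! k $$ (i, j)"
      unfolding tprod_index[OF A B kij]
      using kij j bcirc_carrier[OF A] bcirc_carrier[OF B] block_index_less[OF kij(2,1)]
      by (simp add: first_block_column_def scalar_prod_def atLeast0LessThan)
  qed
  then show ?thesis
    using bcirc_first_block_column block_circulant_mult bcirc_block_circulant A B by metis
qed

lemma tid_tensors: "tid n p \<in> tensors n n p"
  by (simp add: tid_def tensors_def)

lemma bcirc_tid: "bcirc (tid n p) = 1\<^sub>m (n * p)"
proof -
  have "tid n p = first_block_column n p (1\<^sub>m (n * p))"
  proof (rule tensor_eqI[OF tid_tensors first_block_column_tensors])
    fix k i j assume kij: "k < p" "i < n" "j < n"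
    have "j < n * p"
      using block_index_less[of j n 0 p] kij p by simp
    moreover have "k * n + i = j \<longleftrightarrow> k = 0 \<and> i = j"
      using kij by (cases k) auto
    ultimately show "tid n p ! k $$ (i, j) = first_block_column n p (1\<^sub>m (n * p)) ! k $$ (i, j)"
      using kij block_index_less[OF kij(2,1)] by (auto simp: tid_def first_block_column_def)
  qed
  then show ?thesis
    using bcirc_first_block_column[OF block_circulant_one] by simp
qed

lemma tconj_transpose_tensors: "A \<in> tensors n n p \<Longrightarrow> A\<^sup>H \<in> tensors n n p"
  using p by (simp add: tconj_transpose_def tensors_def)

lemma bcirc_tconj_transpose:
  assumes A: "A \<in> tensors n n p"
  shows "bcirc (A\<^sup>H) = mat_adjoint (bcirc A)"
proof -
  have "A\<^sup>H = first_block_column n p (mat_adjoint (bcirc A))"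
  proof (rule tensor_eqI[OF tconj_transpose_tensors[OF A] first_block_column_tensors])
    fix k i j assume kij: "k < p" "i < n" "j < n"
    have j: "j < n * p"
      using block_index_less[of j n 0 p] kij p by simp
    have "A ! ((p - k) mod p) \<in> carrier_mat n n"
      using p tensorsD(2)[OF A] by simp
    then show "A\<^sup>H ! k $$ (i, j) = first_block_column n p (mat_adjoint (bcirc A)) ! k $$ (i, j)"
      using kij j block_index_less[OF kij(2,1)] bcirc_carrier[OF A]
      by (simp add: tconj_transpose_def first_block_column_def tensorsD(1)[OF A] bcirc_index[OF A])
  qed
  then show ?thesis
    using bcirc_first_block_column block_circulant_adjoint bcirc_block_circulant A by metis
qed

lemma tinner_tprod:
  assumes A: "A \<in> tensors n n p" and X: "X \<in> tensors n 1 p"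
  defines "v \<equiv> vec (n * p) (\<lambda>r. X ! (r div n) $$ (r mod n, 0))"
  shows "tinner X (A *\<^sub>T X) = (bcirc A *\<^sub>v v) \<bullet>c v"
proof -
  note Ac = bcirc_carrier[OF A]
  have v: "v $ (k * n + i) = X ! k $$ (i, 0)" if "k < p" "i < n" for k i
    using that by (simp add: v_def block_index_less)
  have Av: "(A *\<^sub>T X) ! k $$ (i, 0) = (bcirc A *\<^sub>v v) $ (k * n + i)" if "k < p" "i < n" for k i
    using that Ac tprod_index[OF A X that]
    by (simp add: block_index_less scalar_prod_def atLeast0LessThan v_def)
  have "tinner X (A *\<^sub>T X) = (\<Sum>i<n. \<Sum>k<p. cnj (X ! k $$ (i, 0)) * (A *\<^sub>T X) ! k $$ (i, 0))"
    using p by (simp add: tinner_def tensorsD[OF X])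
  also have "\<dots> = (\<Sum>i<n. \<Sum>k<p. cnj (v $ (k * n + i)) * (bcirc A *\<^sub>v v) $ (k * n + i))"
    by (intro sum.cong refl) (simp add: v Av)
  also have "\<dots> = (\<Sum>r<n * p. cnj (v $ r) * (bcirc A *\<^sub>v v) $ r)"
    by (rule sum_blocks[symmetric])
  also have "\<dots> = (bcirc A *\<^sub>v v) \<bullet>c v"
  proof -
    have "u \<bullet>c w = (\<Sum>r<n * p. cnj (w $ r) * u $ r)" if "w \<in> carrier_vec (n * p)"
      for u w :: "complex vec"
      using that by (auto simp: scalar_prod_def atLeast0LessThan mult.commute intro!: sum.cong)
    then show ?thesis
      by (simp add: v_def)
  qed
  finally show ?thesis .
qed

text \<open>Stacking the slices of \<open>n\<close> by \<open>1\<close> tensors identifies them with the vectors of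
  length \<open>n * p\<close>, and matches the two quadratic forms.\<close>

lemma Tposdef_iff_posdef_bcirc:
  "A \<in> Tposdef n p \<longleftrightarrow> A \<in> tensors n n p \<and> posdef_mat (n * p) (bcirc A)"
proof (cases "A \<in> tensors n n p")
  case False
  then show ?thesis
    by (simp add: Tposdef_def THermitian_def)
next
  case A: True
  define vec_of where "vec_of X = vec (n * p) (\<lambda>r. X ! (r div n) $$ (r mod n, 0))" for X :: tensor
  define tensor_of where
    "tensor_of v = map (\<lambda>k. mat n 1 (\<lambda>(i, j). v $ (k * n + i))) [0..<p]" for v :: "complex vec"
  have tensor_of: "tensor_of v \<in> tensors n 1 p" for v
    by (simp add: tensor_of_def tensors_def)
  have vec_tensor: "vec_of (tensor_of v) = v" if "v \<in> carrier_vec (n * p)" for v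
    using that by (intro eq_vecI) (auto simp: vec_of_def tensor_of_def block_index)
  have tensor_vec: "tensor_of (vec_of X) = X" if "X \<in> tensors n 1 p" for X
    using that tensor_of
    by (intro tensor_eqI) (auto simp: vec_of_def tensor_of_def block_index_less)
  have zero: "tzero n 1 p \<in> tensors n 1 p" "vec_of (tzero n 1 p) = 0\<^sub>v (n * p)"
    by (auto simp: tzero_def tensors_def vec_of_def block_index)
  have "(\<forall>X \<in> tensors n 1 p. X \<noteq> tzero n 1 p \<longrightarrow> 0 < tinner X (A *\<^sub>T X)) \<longleftrightarrow>
      (\<forall>v \<in> carrier_vec (n * p). v \<noteq> 0\<^sub>v (n * p) \<longrightarrow> 0 < (bcirc A *\<^sub>v v) \<bullet>c v)" (is "?L = ?R")
  proof
    assume L: ?L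
    show ?R
    proof (intro ballI impI)
      fix v :: "complex vec" assume v: "v \<in> carrier_vec (n * p)" "v \<noteq> 0\<^sub>v (n * p)"
      then have "tensor_of v \<noteq> tzero n 1 p"
        using vec_tensor[OF v(1)] zero(2) by auto
      then show "0 < (bcirc A *\<^sub>v v) \<bullet>c v"
        using L tensor_of tinner_tprod[OF A tensor_of, of v] vec_tensor[OF v(1)]
        by (metis vec_of_def)
    qed
  next
    assume R: ?R
    show ?L
    proof (intro ballI impI)
      fix X assume X: "X \<in> tensors n 1 p" "X \<noteq> tzero n 1 p"
      have "vec_of X \<noteq> 0\<^sub>v (n * p)"
        using X zero tensor_vec by metis
      moreover have "vec_of X \<in> carrier_vec (n * p)"
        by (simp add: vec_of_def)
      ultimately show "0 < tinner X (A *\<^sub>T X)"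
        using R tinner_tprod[OF A X(1)] by (metis vec_of_def)
    qed
  qed
  moreover have "A\<^sup>H = A \<longleftrightarrow> mat_adjoint (bcirc A) = bcirc A"
    using bcirc_inject[OF tconj_transpose_tensors[OF A] A] bcirc_tconj_transpose[OF A] by auto
  ultimately show ?thesis
    using A bcirc_carrier[OF A] by (simp add: Tposdef_def THermitian_def posdef_mat_def)
qed

section \<open>The involutive monoid of tensors\<close>

definition tensor_monoid :: "tensor monoid" where
  "tensor_monoid = \<lparr>carrier = tensors n n p, monoid.mult = (*\<^sub>T), one = tid n p\<rparr>"

lemma tensor_monoid_simps [simp]:
  "carrier tensor_monoid = tensors n n p"
  "x \<otimes>\<^bsub>tensor_monoid\<^esub> y = x *\<^sub>T y"
  "\<one>\<^bsub>tensor_monoid\<^esub> = tid n p"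
  by (simp_all add: tensor_monoid_def)

lemma bcirc_reflects_inverse:
  assumes A: "A \<in> tensors n n p" and B: "B \<in> tensors n n p" and AB: "bcirc A * bcirc B = 1\<^sub>m (n * p)"
  shows "A *\<^sub>T B = tid n p"
  using A B AB by (intro bcirc_inject tprod_tensors tid_tensors) (simp_all add: bcirc_tprod bcirc_tid)

lemma Tposdef_Units:
  assumes "A \<in> Tposdef n p"
  shows "A \<in> Units tensor_monoid"
proof -
  have A: "A \<in> tensors n n p" and pd: "posdef_mat (n * p) (bcirc A)"
    using assms by (simp_all add: Tposdef_iff_posdef_bcirc)
  obtain X where X: "X \<in> carrier_mat (n * p) (n * p)"
    and inv: "bcirc A * X = 1\<^sub>m (n * p)" "X * bcirc A = 1\<^sub>m (n * p)"
    using posdef_mat_inverse_ex[OF pd] by blast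
  let ?X = "first_block_column n p X"
  have "bcirc ?X = X"
    using bcirc_first_block_column block_circulant_inverse[OF bcirc_block_circulant[OF A] X inv] by simp
  then have "A *\<^sub>T ?X = tid n p" "?X *\<^sub>T A = tid n p"
    using A inv by (simp_all add: bcirc_reflects_inverse first_block_column_tensors)
  then show ?thesis
    using A first_block_column_tensors by (force simp: Units_def)
qed

lemma Tposdef_congruence:
  assumes C: "C \<in> Units tensor_monoid" and A: "A \<in> Tposdef n p"
  shows "C\<^sup>H *\<^sub>T A *\<^sub>T C \<in> Tposdef n p"
proof -
  obtain D where CD: "C \<in> tensors n n p" "D \<in> tensors n n p" "D *\<^sub>T C = tid n p"
    using C by (auto simp: Units_def)
  have At: "A \<in> tensors n n p" and pd: "posdef_mat (n * p) (bcirc A)"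
    using A by (simp_all add: Tposdef_iff_posdef_bcirc)
  have "bcirc D * bcirc C = 1\<^sub>m (n * p)"
    using CD bcirc_tprod[of D C] by (simp add: bcirc_tid)
  then have "posdef_mat (n * p) (mat_adjoint (bcirc C) * bcirc A * bcirc C)"
    using posdef_mat_congruence[OF pd] bcirc_carrier CD by blast
  then show ?thesis
    using CD At
    by (simp add: Tposdef_iff_posdef_bcirc tprod_tensors tconj_transpose_tensors bcirc_tprod
        bcirc_tconj_transpose)
qed

lemma Tposdef_sqrt_ex1:
  assumes "A \<in> Tposdef n p"
  shows "\<exists>!S. S \<in> Tposdef n p \<and> S *\<^sub>T S = A"
proof -
  have A: "A \<in> tensors n n p" and pd: "posdef_mat (n * p) (bcirc A)"
    using assms by (simp_all add: Tposdef_iff_posdef_bcirc)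
  obtain R where R: "posdef_mat (n * p) R" "R * R = bcirc A"
    using posdef_mat_sqrt_ex[OF pd] by blast
  let ?S = "first_block_column n p R"
  have "R \<in> block_circulant n p"
    using block_circulant_sqrt[OF _ R(1)] bcirc_block_circulant[OF A] R(2) by simp
  then have "bcirc ?S = R"
    by (rule bcirc_first_block_column)
  then have S: "?S \<in> Tposdef n p" "?S *\<^sub>T ?S = A"
    using R A bcirc_inject[OF tprod_tensors A] first_block_column_tensors
    by (simp_all add: Tposdef_iff_posdef_bcirc bcirc_tprod)
  have "T = ?S" if "T \<in> Tposdef n p" "T *\<^sub>T T = A" for T
  proof -
    have T: "T \<in> tensors n n p" "posdef_mat (n * p) (bcirc T)"
      using that by (simp_all add: Tposdef_iff_posdef_bcirc)
    then have "bcirc T * bcirc T = R * R"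
      using R(2) that(2) by (metis bcirc_tprod)
    then have "bcirc T = bcirc ?S"
      using posdef_mat_sqrt_unique[OF T(2) R(1)] \<open>bcirc ?S = R\<close> by simp
    then show ?thesis
      using bcirc_inject T(1) first_block_column_tensors by blast
  qed
  then show ?thesis
    using S by blast
qed

text \<open>The algebraic laws are pulled back along the injective homomorphism \<open>bcirc\<close>.\<close>

lemma involutive_cone_tensors: "involutive_cone tensor_monoid tconj_transpose (Tposdef n p)"
proof (unfold_locales, simp_all only: tensor_monoid_simps)
  show "x *\<^sub>T y \<in> tensors n n p" if "x \<in> tensors n n p" "y \<in> tensors n n p" for x y
    using that by (rule tprod_tensors)
  show "x *\<^sub>T y *\<^sub>T z = x *\<^sub>T (y *\<^sub>T z)"
    if "x \<in> tensors n n p" "y \<in> tensors n n p" "z \<in> tensors n n p" for x y z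
    using that bcirc_carrier assoc_mult_mat[of "bcirc x" "n * p" "n * p" "bcirc y" "n * p" "bcirc z" "n * p"]
    by (intro bcirc_inject) (simp_all add: tprod_tensors bcirc_tprod)
  show "tid n p *\<^sub>T x = x" "x *\<^sub>T tid n p = x" if "x \<in> tensors n n p" for x
    using that bcirc_carrier[OF that]
    by (auto intro!: bcirc_inject simp: tprod_tensors tid_tensors bcirc_tprod bcirc_tid)
  show "(x *\<^sub>T y)\<^sup>H = y\<^sup>H *\<^sub>T x\<^sup>H" if "x \<in> tensors n n p" "y \<in> tensors n n p" for x y
    using that bcirc_carrier
    by (intro bcirc_inject)
       (simp_all add: tprod_tensors tconj_transpose_tensors bcirc_tprod bcirc_tconj_transpose
         mat_adjoint_mult[of _ "n * p" "n * p" _ "n * p"])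
  show "(tid n p)\<^sup>H = tid n p"
    by (intro bcirc_inject) (simp_all add: tid_tensors tconj_transpose_tensors bcirc_tconj_transpose bcirc_tid)
  show "x \<in> Tposdef n p \<Longrightarrow> x\<^sup>H = x" for x
    by (simp add: Tposdef_def THermitian_def)
qed (simp_all add: tid_tensors tconj_transpose_tensors Tposdef_Units Tposdef_congruence Tposdef_sqrt_ex1)

end

theorem theorem3p1:
  fixes n p :: nat and A B :: tensor
  assumes "0 < n" and "0 < p"
    and "A \<in> Tposdef n p" and "B \<in> Tposdef n p"
  shows "A \<sharp> A = A
    \<and> tinv (A \<sharp> B) = tinv A \<sharp> tinv B
    \<and> A \<sharp> B = B \<sharp> A
    \<and> (\<forall>C. tinvertible n p C \<longrightarrow> \<Gamma> C A \<sharp> \<Gamma> C B = \<Gamma> C (A \<sharp> B))"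
proof -
  note p = \<open>0 < p\<close>
  note simps = tensor_monoid_simps[OF p, of n]
  interpret T: involutive_cone "tensor_monoid n p" tconj_transpose "Tposdef n p"
    by (rule involutive_cone_tensors[OF p])
  have carrier: "X \<in> tensors n n p" if "X \<in> Tposdef n p" for X
    using T.cone_carrier[OF that] by (simp add: simps)
  \<comment> \<open>The descriptions that define \<open>tinv\<close> and \<open>tsqrt\<close> take the size from their argument; for tensors of the
    fixed size they are those of the monoid.\<close>
  have tinv: "tinv X = inv\<^bsub>tensor_monoid n p\<^esub> X" if "X \<in> Tposdef n p" for X
    using tensorsD[OF carrier[OF that]] p
    by (simp add: tinv_def is_tinverse_def m_inv_def simps)
  have tsqrt: "tsqrt X = T.psqrt X" if "X \<in> Tposdef n p" for X
    using tensorsD[OF carrier[OF that]] p by (simp add: tsqrt_def T.psqrt_def simps)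
  have mean: "X \<sharp> Y = T.gmean X Y" if "X \<in> Tposdef n p" "Y \<in> Tposdef n p" for X Y
  proof -
    have "T.psqrt X \<in> Tposdef n p"
      using that by (simp add: T.psqrt_cone)
    moreover from this have "tinv (T.psqrt X) *\<^sub>T Y *\<^sub>T tinv (T.psqrt X) \<in> Tposdef n p"
      using T.cone_congruence_self[of "tinv (T.psqrt X)" Y] that by (simp add: tinv T.inv_cone simps)
    ultimately show ?thesis
      using that by (simp add: tgeomean_def T.gmean_def tsqrt simps flip: tinv)
  qed
  have "\<Gamma> C A \<sharp> \<Gamma> C B = \<Gamma> C (A \<sharp> B)" if "tinvertible n p C" for C
  proof -
    have C: "C \<in> Units (tensor_monoid n p)"
      using that p tensorsD[of C n n p]
      by (auto simp: tinvertible_def is_tinverse_def Units_def simps)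
    show ?thesis
      using T.gmean_congruence[OF C assms(3,4)] T.cone_congruence[OF C] assms(3,4)
      by (simp add: Gamma_cong_def mean simps)
  qed
  then show ?thesis
    using assms(3,4) T.gmean_idem T.gmean_commute T.inv_gmean T.gmean_cone T.inv_cone
    by (simp add: mean tinv)
qed

end
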